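(* Let $A$ be a finite set and let $X \subset A^{\mathbb{Z}}$ be a subshift of finite type. Let $\mathcal{C}$ denote the poset of irreducible components of $X$ and let $C \in \mathcal{C}$. Then the following conditions are equivalent: (a) $C$ is isolated in the poset $\mathcal{C}$; (b) $C$ is an open subset of $X$.
   Context: $A^{\mathbb{Z}}$ carries the product topology ($A$ discrete) and the shift homeomorphism $\sigma$, $(\sigma(x))_i = x_{i+1}$. A subshift is a closed subset $X\subset A^{\mathbb{Z}}$ with $\sigma(X)=X$. It is of finite type if there are an integer $n\ge 0$ and $S\subset A^n$ such that $X$ is the set of all $x\in A^{\mathbb{Z}}$ with $(x_{i+1},\dots,x_{i+n})\in S$ for all $i\in\mathbb{Z}$. $\mathrm{NW}(X)$ is the set of $x\in X$ such that for every neighborhood $U$ of $x$ in $X$ there is $n\ge1$ with $U\cap\sigma^n(U)\neq\varnothing$. A subshift $Y$ is irreducible if it is non-empty and for all non-empty open $U,W\subset Y$ there is $n\ge 1$ with $U\cap\sigma^n(W)\ne\varnothing$. For a subshift of finite type $X$, there is a unique finite partition $\mathcal{C}$ of $\mathrm{NW}(X)$ into irreducible subshifts; its elements are the irreducible components of $X$. For $x\in X$, $\alpha(x)$ (resp. $\omega(x)$) is the set of limits of convergent sequences $(\sigma^{-n_k}(x))_k$ (resp. $(\sigma^{n_k}(x))_k$) with $(n_k)$ a strictly increasing sequence of non-negative integers; there are unique $C_\alpha(x),C_\omega(x)\in\mathcal{C}$ with $\alpha(x)\subset C_\alpha(x)$, $\omega(x)\subset C_\omega(x)$. $\mathcal{C}$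 is partially ordered by: $C\preceq C'$ iff there is $x\in X$ with $C_\alpha(x)=C$ and $C_\omega(x)=C'$. An element of a poset is isolated if it is both minimal and maximal. *)

theory Defs
  imports "HOL-Analysis.Analysis" "HOL-Library.Disjoint_Sets"
begin

definition full_shift :: "'a set \<Rightarrow> (int \<Rightarrow> 'a) topology" where
  "full_shift A = product_topology (\<lambda>_. discrete_topology A) UNIV"

definition shift :: "(int \<Rightarrow> 'a) \<Rightarrow> (int \<Rightarrow> 'a)" where
  "shift x = (\<lambda>i. x (i + 1))"

definition subshift :: "'a set \<Rightarrow> (int \<Rightarrow> 'a) set \<Rightarrow> bool" where
  "subshift A X \<longleftrightarrow> closedin (full_shift A) X \<and> shift ` X = X"

definition subshift_of_finite_type :: "'a set \<Rightarrow> (int \<Rightarrow> 'a) set \<Rightarrow> bool" where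
  "subshift_of_finite_type A X \<longleftrightarrow>
     subshift A X \<and>
     (\<exists>(n::nat) S. S \<subseteq> {w. length w = n \<and> set w \<subseteq> A} \<and>
        X = {x \<in> topspace (full_shift A). \<forall>i. map (\<lambda>j. x (i + int j)) [1..<n + 1] \<in> S})"

definition nonwandering :: "'a set \<Rightarrow> (int \<Rightarrow> 'a) set \<Rightarrow> (int \<Rightarrow> 'a) set" where
  "nonwandering A X =
     {x \<in> X. \<forall>U \<subseteq> X. (\<exists>V. openin (subtopology (full_shift A) X) V \<and> x \<in> V \<and> V \<subseteq> U) \<longrightarrow>
        (\<exists>n\<ge>1. U \<inter> (shift ^^ n) ` U \<noteq> {})}"

definition irreducible_subshift :: "'a set \<Rightarrow> (int \<Rightarrow> 'a) set \<Rightarrow> bool" where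
  "irreducible_subshift A Y \<longleftrightarrow>
     subshift A Y \<and> Y \<noteq> {} \<and>
     (\<forall>U W. openin (subtopology (full_shift A) Y) U \<and> U \<noteq> {} \<and>
            openin (subtopology (full_shift A) Y) W \<and> W \<noteq> {} \<longrightarrow>
        (\<exists>n\<ge>1. U \<inter> (shift ^^ n) ` W \<noteq> {}))"

text \<open>Existence and uniqueness of this partition hold for subshifts of finite type; for other
  sets the value is meaningless. The same applies to the two components attached to a point of
  \<open>X\<close> below.\<close>

definition irreducible_components :: "'a set \<Rightarrow> (int \<Rightarrow> 'a) set \<Rightarrow> (int \<Rightarrow> 'a) set set" where
  "irreducible_components A X =
     (THE P. finite P \<and> partition_on (nonwandering A X) P \<and> (\<forall>C\<in>P. irreducible_subshift A C))"

definition alpha_limit_set :: "'a set \<Rightarrow> (int \<Rightarrow> 'a) \<Rightarrow> (int \<Rightarrow> 'a) set" where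
  "alpha_limit_set A x =
     {y. \<exists>n::nat \<Rightarrow> nat. strict_mono n \<and>
         limitin (full_shift A) (\<lambda>k. (inv shift ^^ n k) x) y sequentially}"

definition omega_limit_set :: "'a set \<Rightarrow> (int \<Rightarrow> 'a) \<Rightarrow> (int \<Rightarrow> 'a) set" where
  "omega_limit_set A x =
     {y. \<exists>n::nat \<Rightarrow> nat. strict_mono n \<and>
         limitin (full_shift A) (\<lambda>k. (shift ^^ n k) x) y sequentially}"

definition alpha_component :: "'a set \<Rightarrow> (int \<Rightarrow> 'a) set \<Rightarrow> (int \<Rightarrow> 'a) \<Rightarrow> (int \<Rightarrow> 'a) set" where
  "alpha_component A X x = (THE C. C \<in> irreducible_components A X \<and> alpha_limit_set A x \<subseteq> C)"

definition omega_component :: "'a set \<Rightarrow> (int \<Rightarrow> 'a) set \<Rightarrow> (int \<Rightarrow> 'a) \<Rightarrow> (int \<Rightarrow> 'a) set" where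
  "omega_component A X x = (THE C. C \<in> irreducible_components A X \<and> omega_limit_set A x \<subseteq> C)"

definition component_le ::
    "'a set \<Rightarrow> (int \<Rightarrow> 'a) set \<Rightarrow> (int \<Rightarrow> 'a) set \<Rightarrow> (int \<Rightarrow> 'a) set \<Rightarrow> bool" where
  "component_le A X C C' \<longleftrightarrow>
     (\<exists>x\<in>X. alpha_component A X x = C \<and> omega_component A X x = C')"

definition isolated_in_poset :: "'b set \<Rightarrow> ('b \<Rightarrow> 'b \<Rightarrow> bool) \<Rightarrow> 'b \<Rightarrow> bool" where
  "isolated_in_poset P le c \<longleftrightarrow>
     c \<in> P \<and> (\<forall>d\<in>P. le d c \<longrightarrow> d = c) \<and> (\<forall>d\<in>P. le c d \<longrightarrow> d = c)"

end

theory Submission imports Defs begin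

text \<open>Reading blocks of length \<open>n + 1\<close>, where \<open>n\<close> is the length of the allowed words, identifies \<open>X\<close>
  with the space of bi-infinite paths in a finite graph, so that points can be glued along any
  finite path joining a block of one to a block of the other. A point is non-wandering iff its
  blocks can all reach one another; hence the irreducible components correspond to the strongly
  connected components of the graph that contain a cycle, and the components containing
  \<open>\<alpha>(x)\<close> and \<open>\<omega>(x)\<close> are those in which the path of \<open>x\<close> begins and ends.

  If \<open>C\<close> is open and \<open>x\<close> ends (begins) in \<open>C\<close>, then the past (future) of \<open>x\<close> can be glued to a
  long central block of a point of \<open>C\<close>; openness puts the result in \<open>C\<close>, so \<open>x\<close> also begins (ends)
  in \<open>C\<close>. If \<open>C\<close> is isolated and the central block of \<open>z \<in> X\<close> occurs in \<open>C\<close>, gluing the past and the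
  future of \<open>z\<close> to points of \<open>C\<close> shows that \<open>z\<close> begins and ends in \<open>C\<close>, hence lies in \<open>C\<close>.\<close>

section \<open>The topology of the full shift\<close>

text \<open>The \<open>y\<close> with \<open>agree k x y\<close> form a cylinder. Over all
  \<open>k\<close> these are a countable neighbourhood basis at \<open>x\<close>, in whose terms the
  topology is restated below.\<close>

definition agree :: "nat \<Rightarrow> (int \<Rightarrow> 'a) \<Rightarrow> (int \<Rightarrow> 'a) \<Rightarrow> bool" where
  "agree k x y \<longleftrightarrow> (\<forall>i. \<bar>i\<bar> \<le> int k \<longrightarrow> x i = y i)"

definition translate :: "int \<Rightarrow> (int \<Rightarrow> 'a) \<Rightarrow> (int \<Rightarrow> 'a)" where
  "translate k x = (\<lambda>i. x (i + k))"

lemma agree_refl [simp]: "agree k x x"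
  by (simp add: agree_def)

lemma agree_trans: "agree k x y \<Longrightarrow> agree k y z \<Longrightarrow> agree k x z"
  by (simp add: agree_def)

lemma agree_mono: "agree k x y \<Longrightarrow> l \<le> k \<Longrightarrow> agree l x y"
  by (simp add: agree_def)

lemma topspace_full_shift: "topspace (full_shift A) = {x. range x \<subseteq> A}"
  by (auto simp: full_shift_def PiE_def Pi_def)

text \<open>A basic open set constrains only finitely many coordinates, all within some
  \<open>[-k, k]\<close>; conversely a cylinder is a product of singletons on \<open>[-k, k]\<close>
  and of \<open>A\<close> elsewhere.\<close>

lemma openin_full_shift_iff:
  "openin (full_shift A) U \<longleftrightarrow>
     U \<subseteq> topspace (full_shift A) \<and>
     (\<forall>x\<in>U. \<exists>k. \<forall>y\<in>topspace (full_shift A). agree k x y \<longrightarrow> y \<in> U)"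
    (is "?L \<longleftrightarrow> ?R")
proof
  assume L: ?L
  show ?R
  proof (intro conjI ballI)
    show "U \<subseteq> topspace (full_shift A)" using L by (rule openin_subset)
    fix x assume "x \<in> U"
    with L obtain W where W: "finite {i. W i \<noteq> A}" "\<And>i. W i \<subseteq> A"
        "x \<in> Pi\<^sub>E UNIV W" "Pi\<^sub>E UNIV W \<subseteq> U"
      unfolding full_shift_def openin_product_topology_alt by auto
    \<comment> \<open>\<open>insert 0\<close> keeps \<open>Max\<close> away from the empty set when
      no coordinate is constrained.\<close>
    define k where "k = Max (insert 0 ((\<lambda>i. nat \<bar>i\<bar>) ` {i. W i \<noteq> A}))"
    have k: "nat \<bar>i\<bar> \<le> k" if "W i \<noteq> A" for i
      unfolding k_def using W(1) that by (intro Max_ge) auto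
    have "y \<in> U" if "y \<in> topspace (full_shift A)" "agree k x y" for y
    proof -
      have "y i \<in> W i" for i
      proof (cases "W i = A")
        case True
        then show ?thesis using that(1) by (auto simp: topspace_full_shift)
      next
        case False
        then have "\<bar>i\<bar> \<le> int k" using k[of i] by linarith
        then have "x i = y i" using that(2) by (simp add: agree_def)
        moreover have "x i \<in> W i" using W(3) by auto
        ultimately show ?thesis by simp
      qed
      then show ?thesis using W(4) by auto
    qed
    then show "\<exists>k. \<forall>y\<in>topspace (full_shift A). agree k x y \<longrightarrow> y \<in> U" by blast
  qed
next
  assume R: ?R
  show ?L
    unfolding full_shift_def openin_product_topology_alt
  proof (intro ballI)
    fix x assume x: "x \<in> U"
    with R obtain k where k: "\<forall>y\<in>topspace (full_shift A). agree k x y \<longrightarrow> y \<in> U" by blast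
    have xA: "range x \<subseteq> A" using R x by (auto simp: topspace_full_shift)
    define W where "W i = (if \<bar>i\<bar> \<le> int k then {x i} else A)" for i
    have "{i \<in> UNIV. W i \<noteq> topspace (discrete_topology A)} \<subseteq> {- int k..int k}"
      by (auto simp: W_def split: if_splits)
    then have "finite {i \<in> UNIV. W i \<noteq> topspace (discrete_topology A)}"
      by (rule finite_subset) simp
    moreover have "\<forall>i\<in>UNIV. openin (discrete_topology A) (W i)"
      using xA by (auto simp: W_def)
    moreover have "x \<in> Pi\<^sub>E UNIV W" using xA by (auto simp: W_def)
    moreover have "Pi\<^sub>E UNIV W \<subseteq> U"
    proof
      fix y assume "y \<in> Pi\<^sub>E UNIV W"
      then have y: "y i \<in> W i" for i by auto
      have "y i \<in> A" for i using y[of i] xA by (auto simp: W_def split: if_splits)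
      moreover have "agree k x y" unfolding agree_def
        using y by (metis W_def singletonD)
      ultimately show "y \<in> U" using k by (auto simp: topspace_full_shift)
    qed
    ultimately show "\<exists>W. finite {i \<in> UNIV. W i \<noteq> topspace (discrete_topology A)} \<and>
        (\<forall>i\<in>UNIV. openin (discrete_topology A) (W i)) \<and> x \<in> Pi\<^sub>E UNIV W \<and> Pi\<^sub>E UNIV W \<subseteq> U"
      by blast
  qed
qed

lemma openin_subspace_full_shift_iff:
  assumes Y: "Y \<subseteq> topspace (full_shift A)"
  shows "openin (subtopology (full_shift A) Y) U \<longleftrightarrow>
     U \<subseteq> Y \<and> (\<forall>x\<in>U. \<exists>k. \<forall>y\<in>Y. agree k x y \<longrightarrow> y \<in> U)"
    (is "?L \<longleftrightarrow> ?R")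
proof
  assume ?L
  then obtain T where T: "openin (full_shift A) T" "U = T \<inter> Y"
    by (auto simp: openin_subtopology)
  then show ?R
    unfolding openin_full_shift_iff using Y by blast
next
  assume R: ?R
  \<comment> \<open>The union of the cylinders around points of \<open>U\<close> that meet
    \<open>Y\<close> only inside \<open>U\<close>.\<close>
  define T where "T = {z \<in> topspace (full_shift A).
    \<exists>x k. x \<in> U \<and> (\<forall>y\<in>Y. agree k x y \<longrightarrow> y \<in> U) \<and> agree k x z}"
  have "openin (full_shift A) T"
    unfolding openin_full_shift_iff T_def using agree_trans by blast
  moreover have "U = T \<inter> Y"
    unfolding T_def using R Y agree_refl by blast
  ultimately show ?L by (auto simp: openin_subtopology)
qed

lemma closedin_full_shift_iff:
  "closedin (full_shift A) Y \<longleftrightarrow>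
     Y \<subseteq> topspace (full_shift A) \<and>
     (\<forall>x\<in>topspace (full_shift A). (\<forall>k. \<exists>y\<in>Y. agree k x y) \<longrightarrow> x \<in> Y)"
  unfolding closedin_def openin_full_shift_iff by blast

lemma limitin_full_shift_iff:
  "limitin (full_shift A) f y sequentially \<longleftrightarrow>
     y \<in> topspace (full_shift A) \<and>
     (\<forall>k. \<forall>\<^sub>F n in sequentially. f n \<in> topspace (full_shift A) \<and> agree k y (f n))"
    (is "?L \<longleftrightarrow> ?R")
proof
  assume L: ?L
  have "\<forall>\<^sub>F n in sequentially. f n \<in> topspace (full_shift A) \<and> agree k y (f n)" for k
  proof -
    define U where "U = {z \<in> topspace (full_shift A). agree k y z}"
    have "openin (full_shift A) U"
      unfolding openin_full_shift_iff U_def using agree_trans by blast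
    moreover have "y \<in> U" using L by (auto simp: U_def limitin_def)
    ultimately have "\<forall>\<^sub>F n in sequentially. f n \<in> U" using L by (auto simp: limitin_def)
    then show ?thesis by (simp add: U_def)
  qed
  then show ?R using L by (auto simp: limitin_def)
next
  assume R: ?R
  show ?L
    unfolding limitin_def
  proof (intro conjI allI impI)
    show "y \<in> topspace (full_shift A)" using R by blast
    fix U assume "openin (full_shift A) U \<and> y \<in> U"
    then obtain k where k: "\<forall>z\<in>topspace (full_shift A). agree k y z \<longrightarrow> z \<in> U"
      unfolding openin_full_shift_iff by blast
    have "\<forall>\<^sub>F n in sequentially. f n \<in> topspace (full_shift A) \<and> agree k y (f n)"
      using R by blast
    then show "\<forall>\<^sub>F n in sequentially. f n \<in> U"
      by (rule eventually_mono) (use k in blast)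
  qed
qed

lemma compact_space_full_shift: "finite A \<Longrightarrow> compact_space (full_shift A)"
  unfolding full_shift_def
  by (simp add: compact_space_product_topology compact_space_discrete_topology)

text \<open>A point in the closures of all tails exists by compactness, and the countable cylinder
  basis lets a subsequence converge to it. This later makes limit sets non-empty.\<close>

lemma full_shift_convergent_subsequence:
  assumes "finite A" and f: "\<And>n::nat. f n \<in> topspace (full_shift A)"
  obtains r y where "strict_mono (r :: nat \<Rightarrow> nat)"
    "limitin (full_shift A) (\<lambda>k. f (r k)) y sequentially"
proof -
  define K where "K N = full_shift A closure_of (f ` {N..})" for N
  have "(\<Inter>N. K N) \<noteq> {}"
  proof (rule compact_space_imp_nest)
    show "compact_space (full_shift A)" using assms(1) by (rule compact_space_full_shift)
    show "closedin (full_shift A) (K N)" for N by (simp add: K_def)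
    show "K N \<noteq> {}" for N
    proof -
      have "f ` {N..} \<subseteq> K N" unfolding K_def by (rule closure_of_subset) (use f in auto)
      then show ?thesis by auto
    qed
    show "decseq K" unfolding decseq_def K_def by (auto intro!: closure_of_mono image_mono)
  qed
  then obtain y where y: "\<And>N. y \<in> K N" by auto
  have yA: "y \<in> topspace (full_shift A)"
    using y[of 0] by (simp add: K_def in_closure_of)
  have ex: "\<exists>n>N. agree k y (f n)" for k N
  proof -
    define U where "U = {z \<in> topspace (full_shift A). agree k y z}"
    have "openin (full_shift A) U"
      unfolding openin_full_shift_iff U_def using agree_trans by blast
    moreover have "y \<in> U" using yA by (simp add: U_def)
    ultimately obtain z where "z \<in> f ` {Suc N..}" "z \<in> U"
      using y[of "Suc N"] unfolding K_def in_closure_of by blast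
    then show ?thesis by (auto simp: U_def Suc_le_eq)
  qed
  obtain r where r: "\<And>k. agree k y (f (r k)) \<and> r k < r (Suc k)"
  proof -
    have "\<exists>r. \<forall>k. agree k y (f (r k)) \<and> r k < r (Suc k)"
      by (rule dependent_nat_choice) (use ex in blast)+
    then show thesis using that by blast
  qed
  show thesis
  proof
    show "strict_mono r" using r by (simp add: strict_mono_Suc_iff)
    show "limitin (full_shift A) (\<lambda>k. f (r k)) y sequentially"
      unfolding limitin_full_shift_iff eventually_sequentially
      using yA f r agree_mono by blast
  qed
qed

section \<open>The shift map and decompositions into irreducible subshifts\<close>

lemma shift_funpow: "(shift ^^ n) x = translate (int n) x"
  by (induction n) (auto simp: translate_def shift_def add_ac)

lemma bij_shift: "bij shift"
  by (rule o_bij[of "translate (-1)"]) (auto simp: translate_def shift_def fun_eq_iff)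

lemma inv_shift: "inv shift x = translate (-1) x"
  by (rule inv_f_eq) (auto simp: bij_shift bij_is_inj translate_def shift_def)

lemma inv_shift_funpow: "(inv shift ^^ n) x = translate (- int n) x"
  by (induction n) (auto simp: inv_shift translate_def algebra_simps)

lemma translate_translate [simp]: "translate j (translate k x) = translate (j + k) x"
  by (simp add: translate_def add_ac)

lemma translate_0 [simp]: "translate 0 x = x"
  by (simp add: translate_def)

lemma shift_image_eq_iff:
  "shift ` Y = Y \<longleftrightarrow> (\<forall>x k. x \<in> Y \<longrightarrow> translate k x \<in> Y)"
proof
  assume Y: "shift ` Y = Y"
  have pos: "(shift ^^ n) x \<in> Y" if "x \<in> Y" for n x
    using that Y by (induction n) auto
  have neg: "(inv shift ^^ n) x \<in> Y" if "x \<in> Y" for n x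
    using that
  proof (induction n)
    case (Suc n)
    then obtain z where "z \<in> Y" "(inv shift ^^ n) x = shift z" using Y by blast
    then show ?case by (simp add: bij_shift bij_is_inj)
  qed simp
  show "\<forall>x k. x \<in> Y \<longrightarrow> translate k x \<in> Y"
  proof (intro allI impI)
    fix x and k :: int assume "x \<in> Y"
    then show "translate k x \<in> Y"
      using pos[of x "nat k"] neg[of x "nat (- k)"]
      by (cases "k \<ge> 0") (simp_all add: shift_funpow inv_shift_funpow)
  qed
next
  have s: "shift = translate 1" by (simp add: fun_eq_iff translate_def shift_def)
  assume Y: "\<forall>x k. x \<in> Y \<longrightarrow> translate k x \<in> Y"
  show "shift ` Y = Y"
  proof
    show "shift ` Y \<subseteq> Y" using Y by (auto simp: s)
    show "Y \<subseteq> shift ` Y"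
    proof
      fix x assume "x \<in> Y"
      moreover have "x = shift (translate (-1) x)" by (simp add: s)
      ultimately show "x \<in> shift ` Y" using Y by blast
    qed
  qed
qed

text \<open>As the parts are finitely many, closed and disjoint, each \<open>C \<inter> D\<close> is
  relatively open in \<open>C\<close>. If \<open>C\<close> met two parts, irreducibility would carry
  a point of one into the other, against their invariance.\<close>

lemma irreducible_subshift_subset_part:
  assumes fin: "finite Q" and Q: "disjoint Q" "\<And>D. D \<in> Q \<Longrightarrow> subshift A D"
    and C: "irreducible_subshift A C" "C \<subseteq> \<Union>Q"
  shows "\<exists>D\<in>Q. C \<subseteq> D"
proof -
  have subC: "subshift A C" "C \<noteq> {}" using C(1) by (auto simp: irreducible_subshift_def)
  then obtain x D where D: "x \<in> C" "D \<in> Q" "x \<in> D" using C(2) by blast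
  have inter: "openin (subtopology (full_shift A) C) (C \<inter> D')" if "D' \<in> Q" for D'
  proof -
    have "closedin (full_shift A) (\<Union>(Q - {D'}))"
      using fin Q(2) by (intro closedin_Union) (auto simp: subshift_def)
    then have "openin (full_shift A) (topspace (full_shift A) - \<Union>(Q - {D'}))" by blast
    moreover have "C \<inter> D' = (topspace (full_shift A) - \<Union>(Q - {D'})) \<inter> C"
    proof (intro equalityI subsetI)
      fix z assume z: "z \<in> C \<inter> D'"
      have "C \<subseteq> topspace (full_shift A)"
        using subC(1) by (auto simp: subshift_def dest: closedin_subset)
      moreover have "z \<notin> D''" if "D'' \<in> Q - {D'}" for D''
        using that z \<open>D' \<in> Q\<close> Q(1) by (auto dest: disjointD)
      ultimately show "z \<in> (topspace (full_shift A) - \<Union>(Q - {D'})) \<inter> C" using z by auto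
    next
      fix z assume z: "z \<in> (topspace (full_shift A) - \<Union>(Q - {D'})) \<inter> C"
      then obtain D'' where "D'' \<in> Q" "z \<in> D''" using C(2) by blast
      then show "z \<in> C \<inter> D'" using z by (cases "D'' = D'") auto
    qed
    ultimately show ?thesis by (auto simp: openin_subtopology)
  qed
  have "y \<in> D" if "y \<in> C" for y
  proof (rule ccontr)
    assume "y \<notin> D"
    from that C(2) obtain D' where D': "D' \<in> Q" "y \<in> D'" by blast
    with \<open>y \<notin> D\<close> D(2) Q(1) have disj: "D \<inter> D' = {}" by (auto dest: disjointD)
    have "C \<inter> D \<noteq> {}" "C \<inter> D' \<noteq> {}" using D D' that by auto
    then obtain n where "(C \<inter> D) \<inter> (shift ^^ n) ` (C \<inter> D') \<noteq> {}"
      using C(1) inter[OF D(2)] inter[OF D'(1)] unfolding irreducible_subshift_def by meson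
    then obtain z where "z \<in> D'" "(shift ^^ n) z \<in> D" by blast
    moreover have "(shift ^^ n) z \<in> D'"
      using Q(2)[OF D'(1)] \<open>z \<in> D'\<close> unfolding subshift_def shift_image_eq_iff shift_funpow by blast
    ultimately show False using disj by blast
  qed
  then show ?thesis using D(2) by blast
qed

text \<open>Each \<open>C\<close> of one partition lies in some \<open>D\<close> of the other, and
  \<open>D\<close> in some \<open>C'\<close> of the first; disjointness forces
  \<open>C = D = C'\<close>.\<close>

lemma irreducible_partition_unique:
  assumes P: "finite P" "partition_on N P" "\<forall>C\<in>P. irreducible_subshift A C"
    and Q: "finite Q" "partition_on N Q" "\<forall>C\<in>Q. irreducible_subshift A C"
  shows "P = Q"
proof -
  have *: "P' \<subseteq> Q'"
    if P': "finite P'" "partition_on N P'" "\<forall>C\<in>P'. irreducible_subshift A C"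
    and Q': "finite Q'" "partition_on N Q'" "\<forall>C\<in>Q'. irreducible_subshift A C" for P' Q'
  proof
    fix C assume C: "C \<in> P'"
    have sub: "\<And>D. D \<in> P' \<Longrightarrow> subshift A D" "\<And>D. D \<in> Q' \<Longrightarrow> subshift A D"
      using P'(3) Q'(3) by (auto simp: irreducible_subshift_def)
    have un: "\<Union>P' = N" "\<Union>Q' = N" "disjoint P'" "disjoint Q'"
      using P'(2) Q'(2) by (auto simp: partition_on_def)
    have "irreducible_subshift A C" "C \<subseteq> \<Union>Q'" using C P'(3) un by auto
    from irreducible_subshift_subset_part[OF Q'(1) un(4) sub(2) this]
    obtain D where D: "D \<in> Q'" "C \<subseteq> D" by blast
    then have "irreducible_subshift A D" "D \<subseteq> \<Union>P'" using Q'(3) un by auto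
    from irreducible_subshift_subset_part[OF P'(1) un(3) sub(1) this]
    obtain C' where C': "C' \<in> P'" "D \<subseteq> C'" by blast
    have "C \<noteq> {}" using C P'(3) by (auto simp: irreducible_subshift_def)
    then have "C = C'" using C C' D un(3) by (metis disjointD inf.orderE subset_trans)
    then show "C \<in> Q'" using C' D by auto
  qed
  show ?thesis using *[OF P Q] *[OF Q P] by blast
qed

section \<open>Subshifts of finite type as path spaces\<close>

text \<open>With length \<open>n + 1\<close> the block at \<open>i\<close> contains the positions
  \<open>i + 1, ..., i + n\<close> read by the rule of the subshift, and it is non-empty even for
  \<open>n = 0\<close>, so its first letter recovers \<open>x i\<close>.\<close>

definition window :: "nat \<Rightarrow> (int \<Rightarrow> 'a) \<Rightarrow> int \<Rightarrow> 'a list" where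
  "window n x i = map (\<lambda>j. x (i + int j)) [0..<Suc n]"

lemma window_eq_iff: "window n x i = window n y j \<longleftrightarrow> (\<forall>l\<le>n. x (i + int l) = y (j + int l))"
  by (auto simp: window_def simp del: upt_Suc)

lemma window_translate: "window n (translate k x) i = window n x (i + k)"
  by (simp add: window_def translate_def add_ac del: upt_Suc)

lemma window_nth: "j \<le> n \<Longrightarrow> window n x i ! j = x (i + int j)"
  by (simp add: window_def del: upt_Suc)

lemma agree_window:
  assumes "agree (nat \<bar>i\<bar> + n) x y" shows "window n x i = window n y i"
  unfolding window_eq_iff
proof (intro allI impI)
  fix l assume "l \<le> n"
  then have "\<bar>i + int l\<bar> \<le> int (nat \<bar>i\<bar> + n)" by linarith
  then show "x (i + int l) = y (i + int l)" using assms by (simp add: agree_def)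
qed

lemma agreeI_window:
  assumes "\<And>i. \<bar>i\<bar> \<le> int k \<Longrightarrow> window n x i = window n y i" shows "agree k x y"
  unfolding agree_def
proof (intro allI impI)
  fix i :: int assume "\<bar>i\<bar> \<le> int k"
  then have "window n x i = window n y i" by (rule assms)
  then show "x i = y i" unfolding window_eq_iff by (metis add_0_right le0 of_nat_0)
qed

text \<open>Isolates what finite type is used for: blocks of length \<open>n + 1\<close> decide
  membership, alphabet included. By shift invariance, occurring at position \<open>0\<close> of some
  point is the same as occurring anywhere.\<close>

locale sft =
  fixes A :: "'a set" and X :: "(int \<Rightarrow> 'a) set" and n :: nat
  assumes finite_alphabet: "finite A"
    and subshift: "subshift A X"
    and local_rule: "\<And>z. (\<And>i. \<exists>x\<in>X. window n z i = window n x 0) \<Longrightarrow> z \<in> X"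
begin

definition edges :: "('a list \<times> 'a list) set" where
  "edges = {(window n x 0, window n x 1) | x. x \<in> X}"

text \<open>Paths have positive length, so that \<open>reach u u\<close> means that \<open>u\<close>
  lies on a cycle.\<close>

definition reach :: "'a list \<Rightarrow> 'a list \<Rightarrow> bool" where
  "reach u v \<longleftrightarrow> (u, v) \<in> edges\<^sup>+"

definition linked :: "'a list \<Rightarrow> 'a list \<Rightarrow> bool" where
  "linked u v \<longleftrightarrow> reach u v \<and> reach v u"

text \<open>The paths confined to the strongly connected component of \<open>u\<close>; there are
  none when no cycle passes through \<open>u\<close>.\<close>

definition comp :: "'a list \<Rightarrow> (int \<Rightarrow> 'a) set" where
  "comp u = {x \<in> X. \<forall>i. linked u (window n x i)}"

lemma X_subset: "X \<subseteq> topspace (full_shift A)"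
  using subshift by (auto simp: subshift_def dest: closedin_subset)

lemma translate_in: "x \<in> X \<Longrightarrow> translate k x \<in> X"
  using subshift unfolding subshift_def shift_image_eq_iff by blast

lemma limit_in:
  "x \<in> topspace (full_shift A) \<Longrightarrow> (\<And>k. \<exists>y\<in>X. agree k x y) \<Longrightarrow> x \<in> X"
  using subshift unfolding subshift_def closedin_full_shift_iff by blast

lemma reach_trans: "reach u v \<Longrightarrow> reach v w \<Longrightarrow> reach u w"
  unfolding reach_def by (rule trancl_trans)

lemma linked_sym: "linked u v \<Longrightarrow> linked v u"
  by (auto simp: linked_def)

lemma linked_trans: "linked u v \<Longrightarrow> linked v w \<Longrightarrow> linked u w"
  unfolding linked_def using reach_trans by blast

section \<open>Paths in the block graph and gluing\<close>

lemma window_edge: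
  assumes "x \<in> X" shows "(window n x i, window n x (i + 1)) \<in> edges"
proof -
  have "window n x i = window n (translate i x) 0" "window n x (i + 1) = window n (translate i x) 1"
    by (simp_all add: window_translate add_ac)
  then show ?thesis unfolding edges_def using translate_in[OF assms, of i] by auto
qed

lemma window_reach:
  assumes "x \<in> X" "i < j" shows "reach (window n x i) (window n x j)"
  using assms(2)
proof (induction j rule: int_gr_induct)
  case base
  then show ?case unfolding reach_def using window_edge[OF assms(1)] by blast
next
  case (step j)
  then show ?case unfolding reach_def using window_edge[OF assms(1), of j] by (rule_tac trancl_into_trancl)
qed

text \<open>Consecutive blocks overlap in \<open>n\<close> letters, so letter \<open>j\<close> of
  \<open>p i\<close> is the first letter of \<open>p (i + j)\<close>. The first letters therefore
  spell a sequence with blocks \<open>p i\<close>, all of which occur in \<open>X\<close>.\<close>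

lemma path_realized:
  assumes p: "\<And>i::int. (p i, p (i + 1)) \<in> edges"
  shows "\<exists>z\<in>X. \<forall>i. window n z i = p i"
proof -
  have ex: "\<exists>x\<in>X. p i = window n x 0 \<and> p (i + 1) = window n x 1" for i
    using p[of i] by (auto simp: edges_def)
  define z where "z i = p i ! 0" for i
  have nth: "j \<le> n \<Longrightarrow> p i ! j = z (i + int j)" for i j
  proof (induction j arbitrary: i)
    case (Suc j)
    obtain x where x: "p i = window n x 0" "p (i + 1) = window n x 1" using ex by blast
    have "p i ! Suc j = p (i + 1) ! j" using Suc.prems by (simp add: x window_nth)
    also have "\<dots> = z (i + 1 + int j)" using Suc by simp
    finally show ?case by (simp add: add_ac)
  qed (simp add: z_def)
  have win: "window n z i = p i" for i
  proof -
    obtain x where x: "p i = window n x 0" using ex by blast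
    then have "length (p i) = Suc n" by (simp add: window_def del: upt_Suc)
    then show ?thesis by (intro nth_equalityI) (auto simp: window_def nth simp del: upt_Suc)
  qed
  have "z \<in> X" by (rule local_rule) (use ex win in metis)
  with win show ?thesis by blast
qed

text \<open>Follow \<open>x\<close> up to its block at \<open>a\<close>, walk along a path to the
  block of \<open>y\<close> at \<open>b\<close>, then follow \<open>y\<close>, displaced by
  \<open>d\<close>. The positive length of the path gives \<open>a < b + d\<close>.\<close>

lemma glue:
  assumes x: "x \<in> X" and y: "y \<in> X" and r: "reach (window n x a) (window n y b)"
  shows "\<exists>z d. z \<in> X \<and> a < b + d \<and> (\<forall>i\<le>a. window n z i = window n x i) \<and>
    (\<forall>i\<ge>b. window n z (i + d) = window n y i)"
proof -
  obtain N f where N: "N > 0" and f: "f 0 = window n x a" "f N = window n y b"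
      "\<And>i. i < N \<Longrightarrow> (f i, f (Suc i)) \<in> edges"
    using r unfolding reach_def trancl_power relpow_fun_conv by blast
  \<comment> \<open>The pieces fit because \<open>f 0\<close> and \<open>f N\<close> are the blocks
    of \<open>x\<close> at \<open>a\<close> and of \<open>y\<close> at \<open>b\<close>. The latter
    lands at \<open>a + N\<close>, whence the displacement \<open>a + N - b\<close>.\<close>
  define p where "p i = (if i \<le> a then window n x i else if i \<le> a + int N then f (nat (i - a))
      else window n y (i - a - int N + b))" for i
  have "(p i, p (i + 1)) \<in> edges" for i
  proof -
    consider "i < a" | "a \<le> i" "i < a + int N" | "a + int N \<le> i" by linarith
    then show ?thesis
    proof cases
      case 1
      then show ?thesis using window_edge[OF x] by (simp add: p_def)
    next
      case 2
      have "p i = f (nat (i - a))" using 2 f(1) by (auto simp: p_def)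
      moreover have "p (i + 1) = f (Suc (nat (i - a)))"
        using 2 by (simp add: p_def Suc_nat_eq_nat_zadd1 algebra_simps)
      ultimately show ?thesis using f(3) 2 by simp
    next
      case 3
      have "p i = window n y (i - a - int N + b)"
        using 3 f(2) N by (cases "i = a + int N") (auto simp: p_def)
      moreover have "p (i + 1) = window n y (i - a - int N + b + 1)"
        using 3 by (simp add: p_def algebra_simps)
      ultimately show ?thesis using window_edge[OF y] by simp
    qed
  qed
  then obtain z where z: "z \<in> X" "\<And>i. window n z i = p i" using path_realized[of p] by blast
  show ?thesis
  proof (intro exI[of _ z] exI[of _ "a + int N - b"] conjI allI impI)
    show "window n z (i + (a + int N - b)) = window n y i" if "b \<le> i" for i
      using that f(2) N by (cases "i = b") (auto simp: z p_def)
  qed (use N z in \<open>auto simp: p_def\<close>)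
qed

text \<open>Strongly connected components are convex: a path that leaves one cannot return.\<close>

lemma linked_between:
  assumes "z \<in> X" "a < i" "i < b" "linked u (window n z a)" "linked u (window n z b)"
  shows "linked u (window n z i)"
  using window_reach[OF assms(1,2)] window_reach[OF assms(1,3)] assms(4,5)
  unfolding linked_def by (meson reach_trans)

section \<open>Strongly connected components as irreducible subshifts\<close>

lemma comp_translate: "x \<in> comp u \<Longrightarrow> translate k x \<in> comp u"
  by (simp add: comp_def translate_in window_translate)

lemma comp_limit:
  assumes x: "x \<in> topspace (full_shift A)" and ex: "\<And>k. \<exists>y\<in>comp u. agree k x y"
  shows "x \<in> comp u"
proof -
  have "x \<in> X" using limit_in[OF x] ex by (auto simp: comp_def)
  moreover have "linked u (window n x i)" for i
  proof -
    obtain y where "y \<in> comp u" "agree (nat \<bar>i\<bar> + n) x y" using ex by blast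
    then show ?thesis using agree_window[of i n x y] by (auto simp: comp_def)
  qed
  ultimately show ?thesis by (simp add: comp_def)
qed

text \<open>Run periodically around a cycle through \<open>u\<close>.\<close>

lemma comp_nonempty:
  assumes "reach u u" shows "comp u \<noteq> {}"
proof -
  obtain N f where N: "N > 0" and f: "f 0 = u" "f N = u"
      "\<And>i. i < N \<Longrightarrow> (f i, f (Suc i)) \<in> edges"
    using assms unfolding reach_def trancl_power relpow_fun_conv by blast
  define p where "p i = f (nat (i mod int N))" for i :: int
  have "(p i, p (i + 1)) \<in> edges" for i
  proof -
    define r where "r = nat (i mod int N)"
    have r: "int r = i mod int N" "r < N" using N by (simp_all add: r_def nat_less_iff)
    have next_mod: "(i + 1) mod int N = int (Suc r) mod int N"
      using r(1) by (metis mod_add_left_eq of_nat_Suc add.commute)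
    have "p (i + 1) = f (Suc r)"
    proof (cases "Suc r = N")
      \<comment> \<open>At the end of a period the path closes up, as
        \<open>f N = u = f 0\<close>.\<close>
      case True
      then have "(i + 1) mod int N = 0" using next_mod by simp
      then show ?thesis using True f by (simp add: p_def)
    next
      case False
      then have "(i + 1) mod int N = int (Suc r)" using next_mod r(2) by simp
      then show ?thesis by (simp only: p_def nat_int)
    qed
    moreover have "p i = f r" by (simp add: p_def r_def)
    ultimately show ?thesis using f(3) r(2) by simp
  qed
  then obtain z where z: "z \<in> X" "\<And>i. window n z i = p i" using path_realized[of p] by blast
  have zu: "window n z (int N * j) = u" for j by (simp add: z p_def f)
  have "linked u (window n z i)" for i
  proof -
    \<comment> \<open>The block \<open>u\<close> recurs at every multiple of \<open>N\<close>, hence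
      both before and after \<open>i\<close>.\<close>
    have "i < int N * (\<bar>i\<bar> + 1)" "int N * (- \<bar>i\<bar> - 1) < i"
    proof -
      have "1 * (\<bar>i\<bar> + 1) \<le> int N * (\<bar>i\<bar> + 1)" using N by (intro mult_right_mono) auto
      moreover have "int N * (- \<bar>i\<bar> - 1) = - (int N * (\<bar>i\<bar> + 1))" by (simp add: algebra_simps)
      ultimately show "i < int N * (\<bar>i\<bar> + 1)" "int N * (- \<bar>i\<bar> - 1) < i"
        by (smt (verit))+
    qed
    from window_reach[OF z(1) this(1)] window_reach[OF z(1) this(2)]
    show ?thesis by (simp add: zu linked_def)
  qed
  then show ?thesis using z(1) by (auto simp: comp_def)
qed

lemma comp_eq: "linked u v \<Longrightarrow> comp u = comp v"
  unfolding comp_def using linked_trans linked_sym by blast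

lemma comp_eq_iff:
  assumes "reach u u" shows "comp u = comp v \<longleftrightarrow> linked u v"
proof
  assume eq: "comp u = comp v"
  obtain x where "x \<in> comp u" using comp_nonempty[OF assms] by blast
  then have "linked u (window n x 0)" "linked v (window n x 0)" using eq by (auto simp: comp_def)
  then show "linked u v" using linked_trans linked_sym by blast
qed (rule comp_eq)

lemma subshift_comp: "subshift A (comp u)"
  unfolding subshift_def closedin_full_shift_iff shift_image_eq_iff
  using comp_limit comp_translate X_subset by (auto simp: comp_def)

lemma comp_subset: "comp u \<subseteq> topspace (full_shift A)"
  using X_subset by (auto simp: comp_def)

text \<open>The central part of a point of \<open>W\<close> can be joined to that of a point of
  \<open>U\<close> by a path; convexity keeps the glued point in the component.\<close>

lemma irreducible_comp:
  assumes "reach u u" shows "irreducible_subshift A (comp u)"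
  unfolding irreducible_subshift_def openin_subspace_full_shift_iff[OF comp_subset]
proof (intro conjI allI impI)
  fix U W
  assume "(U \<subseteq> comp u \<and> (\<forall>x\<in>U. \<exists>k. \<forall>y\<in>comp u. agree k x y \<longrightarrow> y \<in> U)) \<and> U \<noteq> {} \<and>
    (W \<subseteq> comp u \<and> (\<forall>x\<in>W. \<exists>k. \<forall>y\<in>comp u. agree k x y \<longrightarrow> y \<in> W)) \<and> W \<noteq> {}"
  then have UW: "U \<subseteq> comp u" "\<forall>x\<in>U. \<exists>k. \<forall>y\<in>comp u. agree k x y \<longrightarrow> y \<in> U" "U \<noteq> {}"
    "W \<subseteq> comp u" "\<forall>x\<in>W. \<exists>k. \<forall>y\<in>comp u. agree k x y \<longrightarrow> y \<in> W" "W \<noteq> {}"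
    by simp_all
  obtain x k where x: "x \<in> comp u" "\<And>z. z \<in> comp u \<Longrightarrow> agree k x z \<Longrightarrow> z \<in> W"
    using UW(4-6) by blast
  obtain y k' where y: "y \<in> comp u" "\<And>z. z \<in> comp u \<Longrightarrow> agree k' y z \<Longrightarrow> z \<in> U"
    using UW(1-3) by blast
  have X: "x \<in> X" "y \<in> X" using x y by (auto simp: comp_def)
  have lx: "linked u (window n x i)" and ly: "linked u (window n y i)" for i
    using x(1) y(1) by (auto simp: comp_def)
  \<comment> \<open>The path leads from the right end of one central part to the left end of the
    other, so both survive gluing. Then \<open>d > k + k'\<close>, so the shift is a positive
    power.\<close>
  have "reach (window n x (int k)) (window n y (- int k'))"
    using lx ly unfolding linked_def by (meson reach_trans)
  from glue[OF X this] obtain z d where z: "z \<in> X" "int k < - int k' + d"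
    "\<And>i. i \<le> int k \<Longrightarrow> window n z i = window n x i"
    "\<And>i. - int k' \<le> i \<Longrightarrow> window n z (i + d) = window n y i" by blast
  have "linked u (window n z i)" for i
  proof -
    consider "i \<le> int k" | "- int k' + d \<le> i" | "int k < i" "i < - int k' + d" by linarith
    then show ?thesis
    proof cases
      case 1
      then show ?thesis using z(3) lx by simp
    next
      case 2
      then show ?thesis using z(4)[of "i - d"] ly by simp
    next
      case 3
      then show ?thesis
        using linked_between[OF z(1) 3] z(3)[of "int k"] z(4)[of "- int k'"] lx ly by simp
    qed
  qed
  then have zC: "z \<in> comp u" using z(1) by (simp add: comp_def)
  have "agree k x z" by (rule agreeI_window[of _ n]) (simp add: z(3))
  then have "z \<in> W" using x zC by blast
  moreover have "agree k' y (translate d z)"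
    by (rule agreeI_window[of _ n]) (simp add: z(4) window_translate)
  then have "translate d z \<in> U" using y comp_translate[OF zC] by blast
  moreover have "translate d z = (shift ^^ nat d) z" using z(2) by (simp add: shift_funpow)
  ultimately have "translate d z \<in> U \<inter> (shift ^^ nat d) ` W" by blast
  moreover have "nat d \<ge> 1" using z(2) by linarith
  ultimately show "\<exists>m\<ge>1. U \<inter> (shift ^^ m) ` W \<noteq> {}" by blast
qed (use assms subshift_comp comp_nonempty in auto)

section \<open>Non-wandering points and the irreducible components\<close>

lemma nonwandering_iff:
  "x \<in> nonwandering A X \<longleftrightarrow> x \<in> X \<and> (\<forall>i j. reach (window n x i) (window n x j))"
    (is "?L \<longleftrightarrow> ?R")
proof
  assume L: ?L
  then have x: "x \<in> X" by (simp add: nonwandering_def)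
  \<comment> \<open>A return of a cylinder around \<open>x\<close> to itself yields a path back from
    the block at \<open>i + 1\<close> to the one at \<open>i\<close>.\<close>
  have step_back: "reach (window n x (i + 1)) (window n x i)" for i
  proof -
    define k where "k = nat \<bar>i\<bar> + nat \<bar>i + 1\<bar> + n"
    define U where "U = {y \<in> X. agree k x y}"
    have "openin (subtopology (full_shift A) X) U"
      unfolding openin_subspace_full_shift_iff[OF X_subset] U_def using agree_trans by blast
    moreover have "x \<in> U" "U \<subseteq> X" using x by (auto simp: U_def)
    ultimately obtain m where m: "m \<ge> 1" "U \<inter> (shift ^^ m) ` U \<noteq> {}"
      using L unfolding nonwandering_def by blast
    then obtain y where y: "y \<in> X" "agree k x y" "agree k x (translate (int m) y)"
      by (auto simp: U_def shift_funpow)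
    have w1: "window n x l = window n y l" if "l = i \<or> l = i + 1" for l
      by (rule agree_window, rule agree_mono[OF y(2)]) (use that in \<open>auto simp: k_def\<close>)
    have w2: "window n x l = window n y (l + int m)" if "l = i \<or> l = i + 1" for l
      unfolding window_translate[symmetric]
      by (rule agree_window, rule agree_mono[OF y(3)]) (use that in \<open>auto simp: k_def\<close>)
    show ?thesis
    proof (cases "m = 1")
      \<comment> \<open>The blocks at \<open>i\<close> and \<open>i + 1\<close> coincide here, so
        the edge of \<open>x\<close> between them is the required loop. For \<open>m > 1\<close> the
        path back runs inside \<open>y\<close>.\<close>
      case True
      have "window n x (i + 1) = window n x i" using w1[of "i + 1"] w2[of i] True by simp
      then show ?thesis using window_reach[OF x, of i "i + 1"] by simp
    next
      case False
      then have "i + 1 < i + int m" using m(1) by linarith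
      from window_reach[OF y(1) this] show ?thesis using w1[of "i + 1"] w2[of i] by simp
    qed
  qed
  have down: "reach (window n x j) (window n x i)" if "i < j" for i j
    using that
  proof (induction j rule: int_gr_induct)
    case base
    then show ?case by (rule step_back)
  next
    case (step j)
    then show ?case using step_back reach_trans by blast
  qed
  have "reach (window n x i) (window n x i)" for i
    by (rule reach_trans[OF window_reach[OF x, of i "i + 1"] step_back]) simp
  then have "reach (window n x i) (window n x j)" for i j
    using down[of j i] window_reach[OF x, of i j] by (cases i j rule: linorder_cases) blast+
  with x show ?R by blast
next
  assume R: ?R
  then have x: "x \<in> X" by blast
  show ?L unfolding nonwandering_def openin_subspace_full_shift_iff[OF X_subset]
  proof (intro CollectI conjI allI impI x)
    fix U assume "U \<subseteq> X" "\<exists>V. (V \<subseteq> X \<and> (\<forall>x\<in>V. \<exists>k. \<forall>y\<in>X. agree k x y \<longrightarrow> y \<in> V)) \<and> x \<in> V \<and> V \<subseteq> U"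
    then obtain k where k: "\<And>y. y \<in> X \<Longrightarrow> agree k x y \<Longrightarrow> y \<in> U" by blast
    \<comment> \<open>Leading the central part of \<open>x\<close> back to its own start makes
      \<open>z\<close> traverse it twice, so that \<open>z\<close> and \<open>translate d z\<close>
      both fall in \<open>U\<close>.\<close>
    have "reach (window n x (int k)) (window n x (- int k))" using R by blast
    from glue[OF x x this] obtain z d where z: "z \<in> X" "int k < - int k + d"
      "\<And>i. i \<le> int k \<Longrightarrow> window n z i = window n x i"
      "\<And>i. - int k \<le> i \<Longrightarrow> window n z (i + d) = window n x i" by blast
    have "agree k x z" by (rule agreeI_window[of _ n]) (simp add: z(3))
    then have "z \<in> U" using k z(1) by blast
    moreover have "agree k x (translate d z)"
      by (rule agreeI_window[of _ n]) (simp add: z(4) window_translate)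
    then have "translate d z \<in> U" using k translate_in[OF z(1)] by blast
    moreover have "translate d z = (shift ^^ nat d) z" using z(2) by (simp add: shift_funpow)
    ultimately have "translate d z \<in> U \<inter> (shift ^^ nat d) ` U" by blast
    moreover have "nat d \<ge> 1" using z(2) by linarith
    ultimately show "\<exists>m\<ge>1. U \<inter> (shift ^^ m) ` U \<noteq> {}" by blast
  qed
qed

lemma window_in: "x \<in> X \<Longrightarrow> window n x i \<in> {w. set w \<subseteq> A \<and> length w = Suc n}"
  using X_subset by (auto simp: window_def topspace_full_shift simp del: upt_Suc)

lemma finite_windows: "finite {w. set w \<subseteq> A \<and> length w = Suc n}"
  using finite_alphabet by (rule finite_lists_length_eq)

lemma reach_window:
  assumes "reach u v" shows "u \<in> {w. set w \<subseteq> A \<and> length w = Suc n}"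
proof -
  obtain w where "(u, w) \<in> edges" using assms unfolding reach_def by (meson tranclD)
  then show ?thesis using window_in unfolding edges_def by blast
qed

text \<open>The strongly connected components with a cycle are finitely many, since the words of
  length \<open>n + 1\<close> over \<open>A\<close> are, and they partition the non-wandering set.
  Uniqueness of such a partition identifies them.\<close>

lemma irreducible_components_eq: "irreducible_components A X = {comp u | u. reach u u}"
proof -
  let ?P = "{comp u | u. reach u u}"
  have "?P \<subseteq> comp ` {w. set w \<subseteq> A \<and> length w = Suc n}" using reach_window by blast
  then have fin: "finite ?P" using finite_windows by (meson finite_imageI finite_subset)
  have part: "partition_on (nonwandering A X) ?P"
  proof (rule partition_onI)
    show "\<Union>?P = nonwandering A X"
    proof (intro equalityI subsetI)
      fix x assume "x \<in> \<Union>?P"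
      then obtain u where "x \<in> comp u" by blast
      then show "x \<in> nonwandering A X"
        unfolding nonwandering_iff comp_def linked_def using reach_trans by blast
    next
      fix x assume "x \<in> nonwandering A X"
      then have "x \<in> comp (window n x 0)" "reach (window n x 0) (window n x 0)"
        by (auto simp: nonwandering_iff comp_def linked_def)
      then show "x \<in> \<Union>?P" by blast
    qed
    show "disjnt p q" if "p \<in> ?P" "q \<in> ?P" "p \<noteq> q" for p q
    proof (rule ccontr)
      assume "\<not> disjnt p q"
      then obtain x where x: "x \<in> p" "x \<in> q" by (auto simp: disjnt_def)
      from that obtain u v where uv: "p = comp u" "q = comp v" by blast
      have "linked u (window n x 0)" "linked v (window n x 0)" using x uv by (auto simp: comp_def)
      then show False using that(3) uv comp_eq by blast
    qed
    show "{} \<notin> ?P" using comp_nonempty by auto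
  qed
  have irr: "\<forall>C\<in>?P. irreducible_subshift A C" using irreducible_comp by blast
  show ?thesis unfolding irreducible_components_def
  proof (rule the_equality)
    show "finite ?P \<and> partition_on (nonwandering A X) ?P \<and> (\<forall>C\<in>?P. irreducible_subshift A C)"
      using fin part irr by blast
  qed (use irreducible_partition_unique fin part irr in blast)
qed

section \<open>Limit sets\<close>

text \<open>By the pigeonhole principle some block recurs infinitely often, and whatever comes after
  one occurrence lies between two. The two cases of \<open>r\<close> serve futures and pasts, the
  latter read backwards.\<close>

lemma eventually_linked:
  assumes p: "\<And>i::nat. p i \<in> {w. set w \<subseteq> A \<and> length w = Suc n}"
    and r: "(\<forall>i j. i < j \<longrightarrow> reach (p i) (p j)) \<or> (\<forall>i j. i < j \<longrightarrow> reach (p j) (p i))"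
  shows "\<exists>u i0. reach u u \<and> (\<forall>i\<ge>i0. linked u (p i))"
proof -
  have "finite (range p)" using p finite_windows by (meson finite_subset image_subsetI)
  then obtain a where a: "infinite {i. p i = p a}"
    using pigeonhole_infinite[of UNIV p] by auto
  have ex: "\<exists>j>i. p j = p a" for i
    using a unfolding infinite_nat_iff_unbounded by blast
  have "linked (p a) (p i)" if "a < i" for i
  proof -
    obtain j where "j > i" "p j = p a" using ex by blast
    then show ?thesis using r that unfolding linked_def by metis
  qed
  moreover have "reach (p a) (p a)" using ex r by metis
  ultimately show ?thesis by (meson Suc_le_eq)
qed

lemma omega_linked:
  assumes "x \<in> X"
  shows "\<exists>u i0. reach u u \<and> (\<forall>i\<ge>i0. linked u (window n x i))"
proof -
  have "\<exists>u i0. reach u u \<and> (\<forall>i\<ge>i0. linked u (window n x (int i)))"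
    by (rule eventually_linked) (use assms window_in window_reach in auto)
  then obtain u i0 where u: "reach u u" "\<And>i. i \<ge> i0 \<Longrightarrow> linked u (window n x (int i))" by blast
  have "linked u (window n x i)" if "i \<ge> int i0" for i
    using u(2)[of "nat i"] that by simp
  with u(1) show ?thesis by blast
qed

lemma alpha_linked:
  assumes "x \<in> X"
  shows "\<exists>u i0. reach u u \<and> (\<forall>i\<le>i0. linked u (window n x i))"
proof -
  have "\<exists>u i0. reach u u \<and> (\<forall>i\<ge>i0. linked u (window n x (- int i)))"
    by (rule eventually_linked) (use assms window_in window_reach in auto)
  then obtain u i0 where u: "reach u u" "\<And>i. i \<ge> i0 \<Longrightarrow> linked u (window n x (- int i))" by blast
  have "linked u (window n x i)" if "i \<le> - int i0" for i
    using u(2)[of "nat (- i)"] that by simp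
  with u(1) show ?thesis by blast
qed

text \<open>Each block of \<open>y\<close> is a block of \<open>x\<close> at a position moved by
  some \<open>s k\<close> with \<open>k\<close> large, so it inherits the link to \<open>u\<close>.
  An arbitrary integer sequence \<open>s\<close> serves both directions of time.\<close>

lemma limit_in_comp:
  assumes x: "x \<in> X" and lim: "limitin (full_shift A) (\<lambda>k. translate (s k) x) y sequentially"
    and ev: "\<And>i. \<forall>\<^sub>F k in sequentially. linked u (window n x (i + s k))"
  shows "y \<in> comp u"
proof -
  have y: "y \<in> topspace (full_shift A)"
    and ag: "\<And>k. \<forall>\<^sub>F m in sequentially. agree k y (translate (s m) x)"
    using lim unfolding limitin_full_shift_iff eventually_conj_iff by auto
  have "y \<in> X"
  proof (rule limit_in[OF y])
    show "\<exists>z\<in>X. agree k y z" for k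
      using eventually_happens'[OF sequentially_bot ag[of k]] translate_in[OF x] by blast
  qed
  moreover have "linked u (window n y i)" for i
  proof -
    obtain m where "agree (nat \<bar>i\<bar> + n) y (translate (s m) x)" "linked u (window n x (i + s m))"
      using eventually_happens'[OF sequentially_bot eventually_conj[OF ag ev]] by blast
    then show ?thesis using agree_window[of i n y "translate (s m) x"]
      by (simp add: window_translate)
  qed
  ultimately show ?thesis by (simp add: comp_def)
qed

text \<open>A point of \<open>L\<close> in two components would have a block linked to both, which
  makes them equal.\<close>

lemma the_component_eq:
  assumes "reach u u" "L \<subseteq> comp u" "L \<noteq> {}"
  shows "(THE C. C \<in> irreducible_components A X \<and> L \<subseteq> C) = comp u"
proof (rule the_equality)
  show "comp u \<in> irreducible_components A X \<and> L \<subseteq> comp u"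
    using assms by (auto simp: irreducible_components_eq)
  fix D assume "D \<in> irreducible_components A X \<and> L \<subseteq> D"
  then obtain v where v: "D = comp v" "L \<subseteq> comp v" by (auto simp: irreducible_components_eq)
  obtain y where "y \<in> comp u" "y \<in> comp v" using assms v by blast
  then have "linked u (window n y 0)" "linked v (window n y 0)" by (auto simp: comp_def)
  then show "D = comp u" using v(1) comp_eq linked_trans linked_sym by blast
qed

lemma omega_component_eq:
  assumes x: "x \<in> X" and u: "reach u u" "\<And>i. i \<ge> i0 \<Longrightarrow> linked u (window n x i)"
  shows "omega_component A X x = comp u"
  unfolding omega_component_def
proof (rule the_component_eq[OF u(1)])
  show "omega_limit_set A x \<subseteq> comp u"
  proof
    fix y assume "y \<in> omega_limit_set A x"
    then obtain r where r: "strict_mono (r :: nat \<Rightarrow> nat)"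
        "limitin (full_shift A) (\<lambda>k. translate (int (r k)) x) y sequentially"
      by (auto simp: omega_limit_set_def shift_funpow)
    show "y \<in> comp u"
    proof (rule limit_in_comp[OF x r(2)])
      fix i
      \<comment> \<open>Strict monotonicity gives \<open>k \<le> r k\<close>, so the position is at
        least \<open>i0\<close>.\<close>
      have "linked u (window n x (i + int (r k)))" if "k \<ge> nat (i0 - i)" for k
        using u(2) that seq_suble[OF r(1), of k] by simp
      then show "\<forall>\<^sub>F k in sequentially. linked u (window n x (i + int (r k)))"
        unfolding eventually_sequentially by blast
    qed
  qed
  have "translate (int k) x \<in> topspace (full_shift A)" for k
    using translate_in[OF x] X_subset by blast
  then show "omega_limit_set A x \<noteq> {}"
    using full_shift_convergent_subsequence[OF finite_alphabet, of "\<lambda>k. translate (int k) x"]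
    unfolding omega_limit_set_def shift_funpow by blast
qed

lemma alpha_component_eq:
  assumes x: "x \<in> X" and u: "reach u u" "\<And>i. i \<le> i0 \<Longrightarrow> linked u (window n x i)"
  shows "alpha_component A X x = comp u"
  unfolding alpha_component_def
proof (rule the_component_eq[OF u(1)])
  show "alpha_limit_set A x \<subseteq> comp u"
  proof
    fix y assume "y \<in> alpha_limit_set A x"
    then obtain r where r: "strict_mono (r :: nat \<Rightarrow> nat)"
        "limitin (full_shift A) (\<lambda>k. translate (- int (r k)) x) y sequentially"
      by (auto simp: alpha_limit_set_def inv_shift_funpow)
    show "y \<in> comp u"
    proof (rule limit_in_comp[OF x r(2)])
      fix i
      have "linked u (window n x (i + - int (r k)))" if "k \<ge> nat (i - i0)" for k
        using u(2) that seq_suble[OF r(1), of k] by simp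
      then show "\<forall>\<^sub>F k in sequentially. linked u (window n x (i + - int (r k)))"
        unfolding eventually_sequentially by blast
    qed
  qed
  have "translate (- int k) x \<in> topspace (full_shift A)" for k
    using translate_in[OF x] X_subset by blast
  then show "alpha_limit_set A x \<noteq> {}"
    using full_shift_convergent_subsequence[OF finite_alphabet, of "\<lambda>k. translate (- int k) x"]
    unfolding alpha_limit_set_def inv_shift_funpow by blast
qed

section \<open>Isolated components are the open ones\<close>

text \<open>The facts \<open>alpha\<close> and \<open>omega\<close> below give minimality and
  maximality, respectively.\<close>

lemma isolated_if_open:
  assumes u: "reach u u" and op: "openin (subtopology (full_shift A) X) (comp u)"
  shows "isolated_in_poset (irreducible_components A X) (component_le A X) (comp u)"
proof -
  obtain y where y: "y \<in> comp u" using comp_nonempty[OF u] by blast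
  then obtain k where k: "\<And>z. z \<in> X \<Longrightarrow> agree k y z \<Longrightarrow> z \<in> comp u"
    using op unfolding openin_subspace_full_shift_iff[OF X_subset] by blast
  have yX: "y \<in> X" and ly: "\<And>i. linked u (window n y i)" using y by (auto simp: comp_def)
  have alpha: "alpha_component A X x = comp u"
    if x: "x \<in> X" and om: "omega_component A X x = comp u" for x
  proof -
    obtain v i0 where v: "reach v v" "\<And>i. i \<ge> i0 \<Longrightarrow> linked v (window n x i)"
      using omega_linked[OF x] by blast
    have "linked v u" using om omega_component_eq[OF x v] comp_eq_iff[OF v(1)] by simp
    then have "reach (window n x i0) (window n y (- int k))"
      using v(2)[of i0] ly unfolding linked_def by (meson order_refl reach_trans)
    \<comment> \<open>\<open>z\<close> has the past of \<open>x\<close>, then the central part and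
      the future of \<open>y\<close>. A translate of it thus lies in the neighbourhood of
      \<open>y\<close> contained in \<open>comp u\<close>.\<close>
    from glue[OF x yX this] obtain z d where z: "z \<in> X" "i0 < - int k + d"
      "\<And>i. i \<le> i0 \<Longrightarrow> window n z i = window n x i"
      "\<And>i. - int k \<le> i \<Longrightarrow> window n z (i + d) = window n y i" by blast
    have "agree k y (translate d z)"
      by (rule agreeI_window[of _ n]) (simp add: z(4) window_translate)
    then have "translate d z \<in> comp u" using k translate_in[OF z(1)] by blast
    from comp_translate[OF this, of "- d"] have "z \<in> comp u" by simp
    then have "linked u (window n x i)" if "i \<le> i0" for i
      using z(3)[OF that, symmetric] by (auto simp: comp_def)
    then show ?thesis by (rule alpha_component_eq[OF x u])
  qed
  have omega: "omega_component A X x = comp u"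
    if x: "x \<in> X" and al: "alpha_component A X x = comp u" for x
  proof -
    obtain v i0 where v: "reach v v" "\<And>i. i \<le> i0 \<Longrightarrow> linked v (window n x i)"
      using alpha_linked[OF x] by blast
    have "linked v u" using al alpha_component_eq[OF x v] comp_eq_iff[OF v(1)] by simp
    then have "reach (window n y (int k)) (window n x i0)"
      using v(2)[of i0] ly unfolding linked_def by (meson order_refl reach_trans)
    \<comment> \<open>In the reverse order the central part of \<open>y\<close> keeps its position,
      so \<open>z\<close> itself lies in the neighbourhood.\<close>
    from glue[OF yX x this] obtain z d where z: "z \<in> X" "int k < i0 + d"
      "\<And>i. i \<le> int k \<Longrightarrow> window n z i = window n y i"
      "\<And>i. i0 \<le> i \<Longrightarrow> window n z (i + d) = window n x i" by blast
    have "agree k y z" by (rule agreeI_window[of _ n]) (simp add: z(3))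
    then have "z \<in> comp u" using k z(1) by blast
    then have "linked u (window n x i)" if "i0 \<le> i" for i
      using z(4)[OF that, symmetric] by (auto simp: comp_def)
    then show ?thesis by (rule omega_component_eq[OF x u])
  qed
  show ?thesis
    unfolding isolated_in_poset_def component_le_def irreducible_components_eq
    using u alpha omega by auto
qed

text \<open>One shared block is enough: by \<open>in_comp\<close>, a point of \<open>X\<close> with
  the same block at \<open>0\<close> as a point of \<open>comp u\<close> lies in
  \<open>comp u\<close>.\<close>

lemma open_if_isolated:
  assumes u: "reach u u"
    and iso: "isolated_in_poset (irreducible_components A X) (component_le A X) (comp u)"
  shows "openin (subtopology (full_shift A) X) (comp u)"
proof -
  have iso_alpha: "comp v = comp u"
    if "reach v v" "x \<in> X" "alpha_component A X x = comp v" "omega_component A X x = comp u" for v x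
    using iso that unfolding isolated_in_poset_def component_le_def irreducible_components_eq by blast
  have iso_omega: "comp v = comp u"
    if "reach v v" "x \<in> X" "alpha_component A X x = comp u" "omega_component A X x = comp v" for v x
    using iso that unfolding isolated_in_poset_def component_le_def irreducible_components_eq by blast
  have in_comp: "z \<in> comp u" if x: "x \<in> comp u" and z: "z \<in> X" and eq: "window n z 0 = window n x 0"
    for x z
  proof -
    have xX: "x \<in> X" and lx: "\<And>i. linked u (window n x i)" using x by (auto simp: comp_def)
    have lz: "linked u (window n z 0)" using lx eq by simp
    have r: "reach (window n x 0) (window n z 0)" "reach (window n z 0) (window n x 0)"
      using lx lz unfolding linked_def by (meson reach_trans)+
    obtain v i0 where v: "reach v v" "\<And>i. i \<ge> i0 \<Longrightarrow> linked v (window n z i)"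
      using omega_linked[OF z] by blast
    have vu: "linked v u"
    proof -
      \<comment> \<open>With the past of \<open>x\<close> and the future of \<open>z\<close>,
        \<open>y\<close> witnesses that \<open>comp u\<close> precedes \<open>comp v\<close>;
        maximality of \<open>comp u\<close> applies.\<close>
      from glue[OF xX z r(1)] obtain y d where y: "y \<in> X" "0 < 0 + d"
        "\<And>i. i \<le> 0 \<Longrightarrow> window n y i = window n x i"
        "\<And>i. 0 \<le> i \<Longrightarrow> window n y (i + d) = window n z i" by blast
      have "alpha_component A X y = comp u"
        by (rule alpha_component_eq[OF y(1) u, of 0]) (simp add: y(3) lx)
      moreover have "omega_component A X y = comp v"
      proof (rule omega_component_eq[OF y(1) v(1), of "max 0 i0 + d"])
        show "linked v (window n y i)" if "max 0 i0 + d \<le> i" for i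
          using y(4)[of "i - d"] v(2)[of "i - d"] that by simp
      qed
      ultimately have "comp v = comp u" using iso_omega[OF v(1) y(1)] by blast
      then show ?thesis using comp_eq_iff[OF v(1)] by simp
    qed
    obtain w j0 where w: "reach w w" "\<And>i. i \<le> j0 \<Longrightarrow> linked w (window n z i)"
      using alpha_linked[OF z] by blast
    have wu: "linked w u"
    proof -
      \<comment> \<open>With the past of \<open>z\<close> and the future of \<open>x\<close>,
        \<open>y\<close> witnesses that \<open>comp w\<close> precedes \<open>comp u\<close>;
        minimality of \<open>comp u\<close> applies.\<close>
      from glue[OF z xX r(2)] obtain y d where y: "y \<in> X" "0 < 0 + d"
        "\<And>i. i \<le> 0 \<Longrightarrow> window n y i = window n z i"
        "\<And>i. 0 \<le> i \<Longrightarrow> window n y (i + d) = window n x i" by blast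
      have "alpha_component A X y = comp w"
        by (rule alpha_component_eq[OF y(1) w(1), of "min 0 j0"]) (simp add: y(3) w(2))
      moreover have "omega_component A X y = comp u"
      proof (rule omega_component_eq[OF y(1) u, of d])
        show "linked u (window n y i)" if "d \<le> i" for i
          using y(4)[of "i - d"] lx that by simp
      qed
      ultimately have "comp w = comp u" using iso_alpha[OF w(1) y(1)] by blast
      then show ?thesis using comp_eq_iff[OF w(1)] by simp
    qed
    \<comment> \<open>\<open>z\<close> begins and ends in the component of \<open>u\<close>, so
      convexity covers every \<open>i\<close>; \<open>min\<close> and \<open>max\<close> supply
      positions strictly on either side of it.\<close>
    have "linked u (window n z i)" for i
    proof (rule linked_between[OF z])
      show "min j0 (i - 1) < i" "i < max i0 (i + 1)" by auto
      show "linked u (window n z (min j0 (i - 1)))"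
        using w(2) wu linked_sym linked_trans by (meson min.cobounded1)
      show "linked u (window n z (max i0 (i + 1)))"
        using v(2) vu linked_sym linked_trans by (meson max.cobounded1)
    qed
    then show ?thesis using z by (simp add: comp_def)
  qed
  show ?thesis
    unfolding openin_subspace_full_shift_iff[OF X_subset]
  proof (intro conjI ballI)
    show "comp u \<subseteq> X" by (auto simp: comp_def)
    fix x assume x: "x \<in> comp u"
    \<comment> \<open>Radius \<open>n\<close> suffices, as \<open>[-n, n]\<close> contains the block
      at \<open>0\<close>.\<close>
    have "z \<in> comp u" if "z \<in> X" "agree n x z" for z
      by (rule in_comp[OF x that(1)]) (use agree_window[of 0 n x z] that(2) in simp)
    then show "\<exists>k. \<forall>y\<in>X. agree k x y \<longrightarrow> y \<in> comp u" by blast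
  qed
qed

end

section \<open>From allowed words to blocks, and the equivalence\<close>

lemma subshift_of_finite_type_imp_sft:
  assumes "finite A" "subshift_of_finite_type A X"
  shows "\<exists>n. sft A X n"
proof -
  obtain n S where X: "subshift A X"
    "X = {x \<in> topspace (full_shift A). \<forall>i. map (\<lambda>j. x (i + int j)) [1..<n + 1] \<in> S}"
    using assms(2) unfolding subshift_of_finite_type_def by blast
  have "sft A X n"
  proof
    fix z assume z: "\<And>i. \<exists>x\<in>X. window n z i = window n x 0"
    \<comment> \<open>The first letter of the block at \<open>i\<close> settles the alphabet, also
      when \<open>n = 0\<close> and the allowed words are empty.\<close>
    have "z i \<in> A" for i
    proof -
      obtain x where x: "x \<in> X" "window n z i = window n x 0" using z by blast
      then have "z i = x 0" by (metis add_0_right le0 of_nat_0 window_eq_iff)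
      then show ?thesis using x(1) X(2) by (auto simp: topspace_full_shift)
    qed
    moreover have "map (\<lambda>j. z (i + int j)) [1..<n + 1] \<in> S" for i
    proof -
      obtain x where x: "x \<in> X" "window n z i = window n x 0" using z by blast
      \<comment> \<open>The word tested at \<open>i\<close> starts at \<open>i + 1\<close>: it is
        the block at \<open>i\<close> without its first letter.\<close>
      then have "map (\<lambda>j. z (i + int j)) [1..<n + 1] = map (\<lambda>j. x (0 + int j)) [1..<n + 1]"
        unfolding window_eq_iff by (intro map_cong) auto
      moreover have "map (\<lambda>j. x (0 + int j)) [1..<n + 1] \<in> S" using x(1) X(2) by blast
      ultimately show ?thesis by (simp only:)
    qed
    ultimately show "z \<in> X" by (subst X(2)) (auto simp: topspace_full_shift)
  qed (use assms(1) X(1) in auto)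
  then show ?thesis by blast
qed

theorem proposition3p10:
  fixes A :: "'a set" and X :: "(int \<Rightarrow> 'a) set" and C :: "(int \<Rightarrow> 'a) set"
  assumes "finite A"
    and "subshift_of_finite_type A X"
    and "C \<in> irreducible_components A X"
  shows "isolated_in_poset (irreducible_components A X) (component_le A X) C
     \<longleftrightarrow> openin (subtopology (full_shift A) X) C"
proof -
  obtain n where "sft A X n" using subshift_of_finite_type_imp_sft[OF assms(1,2)] by blast
  then interpret sft A X n .
  obtain u where "reach u u" "C = comp u" using assms(3) by (auto simp: irreducible_components_eq)
  then show ?thesis using isolated_if_open open_if_isolated by blast
qed

end
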